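(* If a countable Borel equivalence relation $E$ on a standard Borel space $X$ admits a one-ended proper walling, then $E$ is hyperfinite.
   Context: A countable Borel equivalence relation (CBER) is a Borel equivalence relation with countable classes. $E$ is hyperfinite if it is the union of an increasing sequence of Borel equivalence relations with finite classes. A one-ended proper wallspace is an infinite set $C$ equipped with a set $\mathcal I^*\subseteq 2^C$ of finite nonempty subsets such that: (i) every finite $F\subseteq C$ is contained in some $I\in\mathcal I^*$; and (ii) for any $x,y\in C$ there are only finitely many $J\in\mathcal I^*$ with $x\in J\not\ni y$. A one-ended proper walling of a CBER $(X,E)$ is a Borel set $\mathcal I^*$ (in the standard Borel space of finite subsets of $X$) of finite nonempty subsets of $E$-classes, such that for each $E$-class $C$, the set $C$ with $\{I\in\mathcal I^*: I\subseteq C\}$ is a one-ended proper wallspace. *)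

theory Defs
  imports "HOL-Analysis.Analysis"
begin

text \<open>Only the carrier and the sigma-algebra of a value of type \<^typ>\<open>'a measure\<close> matter below; the
  measure itself is never used.\<close>

definition standard_borel :: "'a measure \<Rightarrow> bool" where
  "standard_borel M \<longleftrightarrow>
     (\<exists>T. completely_metrizable_space T \<and> second_countable T \<and> topspace T = space M \<and>
          sets M = sigma_sets (topspace T) {U. openin T U})"

definition borel_equiv :: "'a measure \<Rightarrow> ('a \<times> 'a) set \<Rightarrow> bool" where
  "borel_equiv M E \<longleftrightarrow> equiv (space M) E \<and> E \<in> sets (M \<Otimes>\<^sub>M M)"

definition countable_borel_equiv :: "'a measure \<Rightarrow> ('a \<times> 'a) set \<Rightarrow> bool" where
  "countable_borel_equiv M E \<longleftrightarrow> borel_equiv M E \<and> (\<forall>C \<in> space M // E. countable C)"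

definition finite_borel_equiv :: "'a measure \<Rightarrow> ('a \<times> 'a) set \<Rightarrow> bool" where
  "finite_borel_equiv M E \<longleftrightarrow> borel_equiv M E \<and> (\<forall>C \<in> space M // E. finite C)"

definition hyperfinite :: "'a measure \<Rightarrow> ('a \<times> 'a) set \<Rightarrow> bool" where
  "hyperfinite M E \<longleftrightarrow>
     (\<exists>F :: nat \<Rightarrow> ('a \<times> 'a) set.
        (\<forall>n. finite_borel_equiv M (F n)) \<and> (\<forall>n. F n \<subseteq> F (Suc n)) \<and> E = (\<Union>n. F n))"

text \<open>The Borel space of finite subsets of a standard Borel space carries the Effros sigma-algebra,
  generated by the sets of those \<open>F\<close> that meet a given Borel set. It agrees with the
  quotient sigma-algebra induced by the maps sending a tuple in the \<open>n\<close>-fold power (for each \<open>n\<close>)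
  to its set of entries.\<close>

definition finite_subsets_space :: "'a measure \<Rightarrow> 'a set measure" where
  "finite_subsets_space M =
     sigma {F. finite F \<and> F \<subseteq> space M}
           {{F. finite F \<and> F \<subseteq> space M \<and> F \<inter> A \<noteq> {}} | A. A \<in> sets M}"

definition one_ended_proper_wallspace :: "'a set \<Rightarrow> 'a set set \<Rightarrow> bool" where
  "one_ended_proper_wallspace C W \<longleftrightarrow>
     infinite C \<and>
     (\<forall>I \<in> W. finite I \<and> I \<noteq> {} \<and> I \<subseteq> C) \<and>
     (\<forall>F. finite F \<and> F \<subseteq> C \<longrightarrow> (\<exists>I \<in> W. F \<subseteq> I)) \<and>
     (\<forall>x \<in> C. \<forall>y \<in> C. finite {J \<in> W. x \<in> J \<and> y \<notin> J})"

definition one_ended_proper_walling ::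
    "'a measure \<Rightarrow> ('a \<times> 'a) set \<Rightarrow> 'a set set \<Rightarrow> bool" where
  "one_ended_proper_walling M E W \<longleftrightarrow>
     W \<in> sets (finite_subsets_space M) \<and>
     (\<forall>I \<in> W. finite I \<and> I \<noteq> {} \<and> (\<exists>C \<in> space M // E. I \<subseteq> C)) \<and>
     (\<forall>C \<in> space M // E. one_ended_proper_wallspace C {I \<in> W. I \<subseteq> C})"

end

theory Submission
  imports Defs
begin

text \<open>
  For \<open>n\<close> let \<open>F n\<close> identify two equivalent points when no member of the walling with at least \<open>n\<close>
  elements separates them. These relations increase. Two equivalent points are separated by only
  finitely many members of the walling, all of them finite, so the union is \<open>E\<close>. Every point lies
  in a member \<open>J\<close> with at least \<open>n\<close> elements, and its \<open>F n\<close>-class is contained in \<open>J\<close>, hence finite.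

  That \<open>F n\<close> is Borel needs the theorem that a Borel set with finite sections has a Borel projection,
  since \<open>E - F n\<close> is the projection of a set of pairs together with a separating member of the walling.
  This is proved for Cantor space from Novikov's separation theorem for countably many
  analytic sets, and transferred to standard Borel spaces, which are measurable retracts of Cantor space.
\<close>

subsection \<open>Analytic sets in Cantor space\<close>

text \<open>The Borel sigma-algebra of Cantor space, given as a product so that measurability
  reduces to single coordinates.\<close>

definition cantor :: "(nat \<Rightarrow> bool) measure" where
  "cantor = (\<Pi>\<^sub>M n\<in>UNIV. count_space UNIV)"

lemma space_cantor [simp]: "space cantor = UNIV"
  by (auto simp: cantor_def space_PiM)

lemma measurable_cantor_component [measurable]: "(\<lambda>c. c n) \<in> measurable cantor (count_space UNIV)"
  unfolding cantor_def by measurable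

lemma measurable_cantor_component' [measurable (raw)]:
  assumes "f \<in> measurable M cantor"
  shows "Measurable.pred M (\<lambda>x. f x n)"
  using measurable_compose[OF assms measurable_cantor_component] .

lemma measurable_cantorI:
  assumes "\<And>n. Measurable.pred M (\<lambda>x. f x n)"
  shows "f \<in> measurable M cantor"
  unfolding cantor_def using assms by (intro measurable_PiM_single') auto

lemma pred_cantor_eq [measurable (raw)]:
  assumes [measurable]: "f \<in> measurable M cantor" "g \<in> measurable M cantor"
  shows "Measurable.pred M (\<lambda>x. f x = g x)"
  unfolding fun_eq_iff by measurable

definition analytic_set :: "(nat \<Rightarrow> bool) set \<Rightarrow> bool" where
  "analytic_set A \<longleftrightarrow> (\<exists>S :: ((nat \<Rightarrow> bool) \<times> (nat \<Rightarrow> nat)) set. closed S \<and> A = {c. \<exists>\<sigma>. (c, \<sigma>) \<in> S})"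

lemma analytic_set_closed:
  assumes "closed A"
  shows "analytic_set A"
  unfolding analytic_set_def using assms
  by (intro exI[of _ "A \<times> UNIV"]) (auto intro: closed_Times)

lemma continuous_on_discrete_compose:
  fixes f :: "'a::topological_space \<Rightarrow> 'b::discrete_topology" and h :: "'b \<Rightarrow> 'c::topological_space"
  assumes "continuous_on S f"
  shows "continuous_on S (\<lambda>x. h (f x))"
  by (rule continuous_on_compose2[OF Topological_Spaces.continuous_on_discrete assms subset_UNIV])

text \<open>A point of every \<open>A n\<close> has a sequence of witnesses, which
  \<open>prod_encode\<close> packs into one. Extracting the \<open>n\<close>-th witness is
  continuous, so the condition on the packed witness is closed.\<close>

lemma analytic_set_INT:
  assumes "\<And>n::nat. analytic_set (A n)"
  shows "analytic_set (\<Inter>n. A n)"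
proof -
  obtain S :: "nat \<Rightarrow> ((nat \<Rightarrow> bool) \<times> (nat \<Rightarrow> nat)) set" where cl: "\<And>n. closed (S n)" and A: "\<And>n. A n = {c. \<exists>\<sigma>. (c, \<sigma>) \<in> S n}"
    using assms unfolding analytic_set_def by metis
  define g :: "nat \<Rightarrow> (nat \<Rightarrow> bool) \<times> (nat \<Rightarrow> nat) \<Rightarrow> (nat \<Rightarrow> bool) \<times> (nat \<Rightarrow> nat)"
    where "g n p = (fst p, \<lambda>i. snd p (prod_encode (n, i)))" for n p
  have "continuous_on UNIV (g n)" for n
    unfolding g_def by (intro continuous_intros continuous_on_product_then_coordinatewise)
  then have "closed (\<Inter>n. g n -` S n)"
    using cl by (intro closed_INT ballI closed_vimage)
  moreover have "(\<Inter>n. A n) = {c. \<exists>\<sigma>. (c, \<sigma>) \<in> (\<Inter>n. g n -` S n)}"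
  proof (rule set_eqI, safe)
    fix c assume "c \<in> (\<Inter>n. A n)"
    then obtain \<sigma> where "\<And>n. (c, \<sigma> n) \<in> S n" unfolding A by simp metis
    then show "\<exists>\<tau>. (c, \<tau>) \<in> (\<Inter>n. g n -` S n)"
      by (intro exI[of _ "\<lambda>m. case prod_decode m of (n, i) \<Rightarrow> \<sigma> n i"]) (auto simp: g_def)
  qed (auto simp: A g_def)
  ultimately show ?thesis unfolding analytic_set_def by blast
qed

text \<open>The first entry of a witness names a member of the union; the remaining entries are a
  witness for that member.\<close>

lemma analytic_set_UN:
  assumes "\<And>n::nat. analytic_set (A n)"
  shows "analytic_set (\<Union>n. A n)"
proof -
  obtain S :: "nat \<Rightarrow> ((nat \<Rightarrow> bool) \<times> (nat \<Rightarrow> nat)) set" where cl: "\<And>n. closed (S n)" and A: "\<And>n. A n = {c. \<exists>\<sigma>. (c, \<sigma>) \<in> S n}"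
    using assms unfolding analytic_set_def by metis
  define g :: "(nat \<Rightarrow> bool) \<times> (nat \<Rightarrow> nat) \<Rightarrow> (nat \<Rightarrow> bool) \<times> (nat \<Rightarrow> nat)"
    where "g p = (fst p, \<lambda>i. snd p (Suc i))" for p
  have g: "continuous_on UNIV g"
    unfolding g_def by (intro continuous_intros continuous_on_product_then_coordinatewise)
  have h: "continuous_on UNIV (\<lambda>p :: (nat \<Rightarrow> bool) \<times> (nat \<Rightarrow> nat). snd p 0)"
    by (intro continuous_intros continuous_on_product_then_coordinatewise)
  define T where "T = {p. g p \<in> S (snd p 0)}"
  have "closed T"
  proof -
    have "- T = (\<Union>n. (\<lambda>p. snd p 0) -` {n} \<inter> - (g -` S n))" by (auto simp: T_def)
    moreover have "open \<dots>"
      using cl g h by (intro open_UN ballI open_Int open_Compl closed_vimage open_vimage open_discrete)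
    ultimately show ?thesis by (simp add: closed_def)
  qed
  moreover have "(\<Union>n. A n) = {c. \<exists>\<sigma>. (c, \<sigma>) \<in> T}"
  proof (rule set_eqI, safe)
    fix c n assume "c \<in> A n"
    then obtain \<sigma> where "(c, \<sigma>) \<in> S n" unfolding A by blast
    then show "\<exists>\<tau>. (c, \<tau>) \<in> T"
      by (intro exI[of _ "case_nat n \<sigma>"]) (auto simp: g_def T_def)
  qed (auto simp: A g_def T_def)
  ultimately show ?thesis unfolding analytic_set_def by blast
qed

text \<open>Analyticity does not pass to complements, so the induction carries each set together
  with its complement, starting from clopen cylinders.\<close>

lemma analytic_set_borel:
  assumes "A \<in> sets cantor"
  shows "analytic_set A"
proof -
  have "A \<in> sigma_sets UNIV {{c. c i \<in> B} | i (B :: bool set). True}"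
    using assms unfolding cantor_def sets_PiM_single by (simp add: space_PiM)
  then have "analytic_set A \<and> analytic_set (- A)"
  proof (induction rule: sigma_sets.induct)
    case (Basic a)
    then obtain i B where a: "a = {c :: nat \<Rightarrow> bool. c i \<in> B}" by blast
    have "closed ((\<lambda>c :: nat \<Rightarrow> bool. c i) -` D)" for D
      by (intro closed_vimage continuous_on_product_coordinates) (simp add: closed_def open_discrete)
    from this[of B] this[of "- B"] show ?case
      unfolding a by (intro conjI analytic_set_closed) (simp_all add: vimage_def Collect_neg_eq)
  next
    case (Union a)
    then show ?case by (simp add: analytic_set_UN analytic_set_INT)
  qed (auto intro: analytic_set_closed simp flip: Compl_eq_Diff_UNIV)
  then show ?thesis ..
qed

section \<open>Pairs of sequences as single sequences, and projections\<close>

definition interleave :: "(nat \<Rightarrow> 'a) \<Rightarrow> (nat \<Rightarrow> 'a) \<Rightarrow> nat \<Rightarrow> 'a" where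
  "interleave u v n = (if even n then u (n div 2) else v (n div 2))"

definition evens :: "(nat \<Rightarrow> 'a) \<Rightarrow> nat \<Rightarrow> 'a" where "evens w n = w (2 * n)"

definition odds :: "(nat \<Rightarrow> 'a) \<Rightarrow> nat \<Rightarrow> 'a" where "odds w n = w (2 * n + 1)"

lemma evens_interleave [simp]: "evens (interleave u v) = u"
  and odds_interleave [simp]: "odds (interleave u v) = v"
  by (auto simp: fun_eq_iff evens_def odds_def interleave_def)

lemma interleave_evens_odds [simp]: "interleave (evens w) (odds w) = w"
  by (auto simp: fun_eq_iff evens_def odds_def interleave_def)

lemma measurable_evens [measurable]: "evens \<in> measurable cantor cantor"
  and measurable_odds [measurable]: "odds \<in> measurable cantor cantor"
  unfolding evens_def odds_def by (auto intro!: measurable_cantorI)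

lemma measurable_interleave [measurable (raw)]:
  assumes [measurable]: "f \<in> measurable M cantor" "g \<in> measurable M cantor"
  shows "(\<lambda>x. interleave (f x) (g x)) \<in> measurable M cantor"
  by (rule measurable_cantorI) (simp add: interleave_def)

text \<open>The sequence \<open>v\<close> and the witness are merged into one \<open>\<tau>\<close>:
  even entries store \<open>v\<close> (nonzero means true), odd entries store the witness.\<close>

lemma analytic_set_projection:
  assumes "analytic_set A"
  shows "analytic_set {u. \<exists>v. interleave u v \<in> A}"
proof -
  obtain S :: "((nat \<Rightarrow> bool) \<times> (nat \<Rightarrow> nat)) set" where cl: "closed S" and A: "A = {c. \<exists>\<sigma>. (c, \<sigma>) \<in> S}"
    using assms unfolding analytic_set_def by metis
  define h where "h p n = (if even n then fst p (n div 2) else snd p (2 * (n div 2)) \<noteq> 0)"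
    for p :: "(nat \<Rightarrow> bool) \<times> (nat \<Rightarrow> nat)" and n
  define g where "g p = (h p, odds (snd p))" for p
  have hn: "continuous_on UNIV (\<lambda>p. h p n)" for n
  proof (cases "even n")
    case True
    have "continuous_on UNIV (\<lambda>p::(nat \<Rightarrow> bool) \<times> (nat \<Rightarrow> nat). fst p (n div 2))"
      by (rule continuous_on_product_then_coordinatewise[OF continuous_on_fst[OF continuous_on_id]])
    with True show ?thesis by (simp add: h_def)
  next
    case False
    have "continuous_on UNIV (\<lambda>p::(nat \<Rightarrow> bool) \<times> (nat \<Rightarrow> nat). snd p (2 * (n div 2)))"
      by (rule continuous_on_product_then_coordinatewise[OF continuous_on_snd[OF continuous_on_id]])
    from continuous_on_discrete_compose[OF this, of "\<lambda>m. m \<noteq> 0"] False show ?thesis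
      by (simp add: h_def)
  qed
  have "continuous_on UNIV g"
    unfolding g_def odds_def
    by (intro continuous_on_Pair continuous_on_coordinatewise_then_product
        continuous_on_product_then_coordinatewise[OF continuous_on_snd] continuous_on_id hn)
  then have "closed (g -` S)" using cl by (rule closed_vimage[rotated])
  moreover have "{u. \<exists>v. interleave u v \<in> A} = {u. \<exists>\<tau>. g (u, \<tau>) \<in> S}"
  proof (rule set_eqI, safe)
    fix u v assume "interleave u v \<in> A"
    then obtain \<sigma> where \<sigma>: "(interleave u v, \<sigma>) \<in> S" unfolding A by blast
    define \<tau> where "\<tau> = interleave (\<lambda>n. of_bool (v n)) \<sigma>"
    have "h (u, \<tau>) = interleave u v"
      by (auto simp: fun_eq_iff h_def \<tau>_def interleave_def elim!: oddE)
    with \<sigma> have "g (u, \<tau>) \<in> S" by (simp add: g_def \<tau>_def)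
    then show "\<exists>\<tau>. g (u, \<tau>) \<in> S" by blast
  next
    fix u \<tau> assume "g (u, \<tau>) \<in> S"
    moreover have "h (u, \<tau>) = interleave u (\<lambda>n. evens \<tau> n \<noteq> 0)"
      by (auto simp: fun_eq_iff h_def interleave_def evens_def)
    ultimately show "\<exists>v. interleave u v \<in> A" unfolding A g_def by auto
  qed
  ultimately show ?thesis unfolding analytic_set_def by (intro exI[of _ "g -` S"]) simp
qed

subsection \<open>Separation of analytic sets\<close>

definition separable_family :: "(nat \<Rightarrow> (nat \<Rightarrow> bool) set) \<Rightarrow> bool" where
  "separable_family P \<longleftrightarrow>
     (\<exists>Q. (\<forall>n. Q n \<in> sets cantor \<and> P n \<subseteq> Q n) \<and> (\<Inter>n. Q n) = {})"

text \<open>Hulls of the pieces are united at \<open>k\<close>, and hulls of the other members are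
  intersected over \<open>j\<close>. Contrapositively, an inseparable family stays inseparable for
  one of the pieces.\<close>

lemma separable_family_split:
  assumes split: "P k = (\<Union>j::nat. R j k)"
    and other: "\<And>n j. n \<noteq> k \<Longrightarrow> R j n = P n"
    and sep: "\<And>j. separable_family (R j)"
  shows "separable_family P"
proof -
  obtain Q where Q: "\<And>j n. Q j n \<in> sets cantor" "\<And>j n. R j n \<subseteq> Q j n" "\<And>j. (\<Inter>n. Q j n) = {}"
    using sep unfolding separable_family_def by metis
  define Q' where "Q' n = (if n = k then (\<Union>j. Q j n) else (\<Inter>j. Q j n))" for n
  have "Q' n \<in> sets cantor" for n
    unfolding Q'_def using Q(1) by auto
  moreover have "P n \<subseteq> Q' n" for n
  proof (cases "n = k")
    case True
    have "(\<Union>j. R j k) \<subseteq> (\<Union>j. Q j k)" using Q(2) by (rule UN_mono[OF order_refl])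
    with True split show ?thesis by (simp add: Q'_def)
  next
    case False
    have "P n \<subseteq> Q j n" for j using Q(2)[of j n] other[OF False, of j] by simp
    with False show ?thesis by (auto simp: Q'_def)
  qed
  moreover have "(\<Inter>n. Q' n) = {}"
  proof (rule equals0I)
    fix c assume c: "c \<in> (\<Inter>n. Q' n)"
    then have "c \<in> Q' k" by blast
    then obtain j where j: "c \<in> Q j k" by (auto simp: Q'_def)
    have "c \<in> Q j n" for n
      using c j by (cases "n = k") (auto simp: Q'_def dest!: INT_D[of _ _ _ n] split: if_splits)
    then show False using Q(3)[of j] by blast
  qed
  ultimately show ?thesis unfolding separable_family_def by blast
qed

text \<open>Each coordinate of the approximating points is eventually constant, so they converge to
  \<open>x\<close> in the product topology.\<close>

lemma closed_prefix_limit: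
  fixes S :: "(nat \<Rightarrow> 'b::topological_space) set"
  assumes "closed S" and ex: "\<And>m. \<exists>y\<in>S. \<forall>i<m. y i = x i"
  shows "x \<in> S"
proof -
  obtain Y where Y: "\<And>m. Y m \<in> S" "\<And>m i. i < m \<Longrightarrow> Y m i = x i"
    using ex by metis
  have "(\<lambda>m. Y m i) \<longlonglongrightarrow> x i" for i
    by (rule tendsto_eventually, rule eventually_mono[OF eventually_gt_at_top[of i]]) (rule Y(2))
  then have "Y \<longlonglongrightarrow> x"
    using limitin_componentwise[of "\<lambda>_. euclidean" UNIV Y x sequentially]
    by (simp add: euclidean_product_topology)
  with \<open>closed S\<close> Y(1) show ?thesis
    using Lim_in_closed_set[of S Y sequentially x] by simp
qed

text \<open>A pair in \<open>2\<^sup>\<omega> \<times> \<omega>\<^sup>\<omega>\<close> is read off a single sequence of numbers: the point of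
  Cantor space from the even entries, the witness from the odd ones.\<close>

definition point_of :: "(nat \<Rightarrow> nat) \<Rightarrow> nat \<Rightarrow> bool" where
  "point_of \<rho> i \<longleftrightarrow> evens \<rho> i \<noteq> 0"

lemma analytic_set_image_closed:
  assumes "analytic_set A"
  shows "\<exists>S. closed S \<and> A = point_of ` S"
proof -
  obtain T :: "((nat \<Rightarrow> bool) \<times> (nat \<Rightarrow> nat)) set" where cl: "closed T" and A: "A = {c. \<exists>\<sigma>. (c, \<sigma>) \<in> T}"
    using assms unfolding analytic_set_def by metis
  define g where "g \<rho> = (point_of \<rho>, odds \<rho>)" for \<rho>
  have "continuous_on UNIV (\<lambda>\<rho>. point_of \<rho> i)" for i
    unfolding point_of_def evens_def
    by (rule continuous_on_discrete_compose[OF continuous_on_product_coordinates, where h = "\<lambda>m. m \<noteq> 0"])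
  then have "continuous_on UNIV g"
    unfolding g_def odds_def
    by (intro continuous_on_Pair continuous_on_coordinatewise_then_product continuous_on_product_coordinates)
  then have "closed (g -` T)" using cl by (rule closed_vimage[rotated])
  moreover have "A = point_of ` (g -` T)"
  proof (rule set_eqI, safe)
    fix c assume "c \<in> A"
    then obtain \<sigma> where \<sigma>: "(c, \<sigma>) \<in> T" unfolding A by blast
    have "point_of (interleave (\<lambda>i. of_bool (c i)) \<sigma>) = c"
      by (simp add: fun_eq_iff point_of_def)
    with \<sigma> show "c \<in> point_of ` (g -` T)"
      by (intro image_eqI[of _ _ "interleave (\<lambda>i. of_bool (c i)) \<sigma>"]) (auto simp: g_def)
  qed (auto simp: A g_def)
  ultimately show ?thesis by blast
qed

text \<open>\<open>\<tau>\<close> codes one sequence \<open>row n\<close> for each set of the family, and \<open>P t \<tau>\<close> is the subfamily of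
  points that have a witness agreeing with the first \<open>t\<close> entries of \<open>\<tau>\<close>. Inseparability is kept while
  \<open>\<tau>\<close> is extended by one entry at a time; in the limit all rows must code one common point.\<close>

theorem novikov_separation:
  assumes an: "\<And>n. analytic_set (A n)" and disj: "(\<Inter>n. A n) = {}"
  shows "separable_family A"
proof (rule ccontr)
  assume nsep: "\<not> separable_family A"
  obtain S where cl: "\<And>n. closed (S n)" and A: "\<And>n. A n = point_of ` S n"
    using analytic_set_image_closed[OF an] by metis
  define P where "P t \<tau> n =
      {point_of \<rho> | \<rho>. \<rho> \<in> S n \<and> (\<forall>i. prod_encode (n, i) < t \<longrightarrow> \<rho> i = \<tau> (prod_encode (n, i)))}"
    for t \<tau> n
  have step: "\<exists>j. \<not> separable_family (P (Suc t) (\<tau>(t := j)))"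
    if "\<not> separable_family (P t \<tau>)" for t \<tau>
  proof (rule ccontr)
    assume no: "\<nexists>j. \<not> separable_family (P (Suc t) (\<tau>(t := j)))"
    \<comment> \<open>Position \<open>t\<close> belongs to row \<open>k\<close> only: fixing its
      entry splits the \<open>k\<close>-th member into countably many pieces and leaves the others
      unchanged.\<close>
    obtain k l where kl: "t = prod_encode (k, l)"
      by (metis prod_decode_inverse surj_pair)
    have "separable_family (P t \<tau>)"
    proof (rule separable_family_split[where k = k and R = "\<lambda>j. P (Suc t) (\<tau>(t := j))"])
      show "P t \<tau> k = (\<Union>j. P (Suc t) (\<tau>(t := j)) k)"
        by (force simp: P_def kl less_Suc_eq)
      show "P (Suc t) (\<tau>(t := j)) n = P t \<tau> n" if "n \<noteq> k" for n j
        using that by (auto simp: P_def kl less_Suc_eq)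
    qed (use no in blast)
    with that show False by blast
  qed
  define pick where "pick t \<tau> = \<tau>(t := SOME j. \<not> separable_family (P (Suc t) (\<tau>(t := j))))" for t and \<tau> :: "nat \<Rightarrow> nat"
  define approx where "approx = rec_nat (\<lambda>_. 0) pick"
  have app: "\<not> separable_family (P t (approx t))" for t
  proof (induction t)
    case 0
    have "P 0 (approx 0) = A" by (auto simp: P_def A fun_eq_iff)
    with nsep show ?case by simp
  next
    case (Suc t)
    have "approx (Suc t) = pick t (approx t)" by (simp add: approx_def)
    then show ?case unfolding pick_def by (rule ssubst) (rule someI_ex[OF step[OF Suc]])
  qed
  \<comment> \<open>Entry \<open>i\<close> is chosen at stage \<open>i\<close> and never changed
    later, so this diagonal is the limit.\<close>
  define \<tau> where "\<tau> i = approx (Suc i) i" for i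
  have approx_eq: "approx t i = \<tau> i" if "i < t" for i t
    using that by (induction t) (auto simp: \<tau>_def approx_def pick_def less_Suc_eq)
  have nsepP: "\<not> separable_family (P t \<tau>)" for t
  proof -
    have "P t \<tau> = P t (approx t)"
      by (auto simp: P_def fun_eq_iff approx_eq)
    with app show ?thesis by simp
  qed
  define row where "row n i = \<tau> (prod_encode (n, i))" for n i
  have bound: "\<exists>t. \<forall>i<m. prod_encode (n, i) < t" for n m :: nat
    by (rule exI[of _ "Suc (Max ((\<lambda>i. prod_encode (n, i)) ` {..<m}))"]) (auto simp: less_Suc_eq_le)
  have row_mem: "row n \<in> S n" for n
  proof (rule closed_prefix_limit[OF cl])
    fix m
    obtain t where t: "\<forall>i<m. prod_encode (n, i) < t" using bound by blast
    have "P t \<tau> n \<noteq> {}"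
    proof
      assume "P t \<tau> n = {}"
      then have "separable_family (P t \<tau>)"
        unfolding separable_family_def
        by (intro exI[of _ "\<lambda>n'. if n' = n then {} else UNIV"])
          (use sets.top[of cantor] in \<open>auto split: if_splits\<close>)
      with nsepP show False by blast
    qed
    then obtain \<rho> where "\<rho> \<in> S n" "\<forall>i. prod_encode (n, i) < t \<longrightarrow> \<rho> i = \<tau> (prod_encode (n, i))"
      unfolding P_def by blast
    with t show "\<exists>y\<in>S n. \<forall>i<m. y i = row n i"
      unfolding row_def by (intro bexI[of _ \<rho>]) auto
  qed
  have same: "point_of (row n) = point_of (row 0)" for n
  proof (rule ccontr)
    assume "point_of (row n) \<noteq> point_of (row 0)"
    then obtain i where i: "point_of (row n) i \<noteq> point_of (row 0) i" by blast
    \<comment> \<open>Bit \<open>i\<close> of a coded point is decided by entry \<open>2 * i\<close>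
      of its row. Once both entries are fixed, two disjoint cylinders separate the family.\<close>
    obtain t1 t2 where "\<forall>j<Suc (2 * i). prod_encode (n, j) < t1" "\<forall>j<Suc (2 * i). prod_encode (0, j) < t2"
      using bound by metis
    then have t: "prod_encode (n, 2 * i) < max t1 t2" "prod_encode (0, 2 * i) < max t1 t2"
      by (simp_all add: less_max_iff_disj)
    define Q where "Q m = (if m = n then {c. c i = point_of (row n) i}
        else if m = 0 then {c. c i = point_of (row 0) i} else UNIV)" for m
    have "{c. c i = b} \<in> sets cantor" for b
      using measurable_sets[OF measurable_cantor_component[of i], of "{b}"] by (simp add: vimage_def)
    then have "Q m \<in> sets cantor" for m
      unfolding Q_def using sets.top[of cantor] by simp
    moreover have "P (max t1 t2) \<tau> m \<subseteq> Q m" for m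
      using t by (auto simp: P_def Q_def point_of_def evens_def row_def)
    moreover have "(\<Inter>m. Q m) = {}"
    proof (rule equals0I)
      fix c assume "c \<in> (\<Inter>m. Q m)"
      then have "c \<in> Q n" "c \<in> Q 0" by blast+
      with i show False by (auto simp: Q_def split: if_splits)
    qed
    ultimately have "separable_family (P (max t1 t2) \<tau>)" unfolding separable_family_def by blast
    with nsepP show False by blast
  qed
  have "point_of (row 0) \<in> A n" for n
    using row_mem[of n] same[of n] unfolding A by (metis imageI)
  with disj show False by blast
qed

text \<open>Novikov separation for \<open>A, B, B, ...\<close>: a point of \<open>B\<close> lies in
  every hull after the first, hence not in the first.\<close>

corollary lusin_separation:
  assumes "analytic_set A" "analytic_set B" "A \<inter> B = {}"
  obtains Q where "Q \<in> sets cantor" "A \<subseteq> Q" "Q \<inter> B = {}"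
proof -
  define P where "P n = (if n = 0 then A else B)" for n :: nat
  have "separable_family P"
    using assms by (intro novikov_separation) (auto simp: P_def split: if_splits intro: exI[of _ "1::nat"])
  then obtain Q where Q: "\<And>n. Q n \<in> sets cantor" "\<And>n. P n \<subseteq> Q n" "(\<Inter>n. Q n) = {}"
    unfolding separable_family_def by blast
  have "Q 0 \<inter> B = {}"
  proof (rule equals0I)
    fix c assume c: "c \<in> Q 0 \<inter> B"
    then have "c \<in> Q n" for n using Q(2)[of n] by (cases "n = 0") (auto simp: P_def)
    with Q(3) show False by blast
  qed
  with Q(1)[of 0] Q(2)[of 0] show ?thesis by (intro that[of "Q 0"]) (auto simp: P_def)
qed

subsection \<open>Projections of Borel sets with closed sections\<close>

text \<open>The word of the first \<open>k\<close> entries, padded with \<open>False\<close> so as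
  to be a point of Cantor space again.\<close>

definition cut :: "nat \<Rightarrow> (nat \<Rightarrow> bool) \<Rightarrow> nat \<Rightarrow> bool" where
  "cut k y i \<longleftrightarrow> i < k \<and> y i"

lemma cut_eq_iff: "cut k x = cut k y \<longleftrightarrow> (\<forall>i<k. x i = y i)"
  by (auto simp: cut_def fun_eq_iff)

lemma cut_cut: "k \<le> m \<Longrightarrow> cut k (cut m y) = cut k y"
  by (auto simp: cut_def fun_eq_iff)

lemma finite_range_cut: "finite (range (cut k))"
proof -
  have "range (cut k) \<subseteq> {f. \<forall>i. (i \<in> {..<k} \<longrightarrow> f i \<in> UNIV) \<and> (i \<notin> {..<k} \<longrightarrow> f i = False)}"
    by (auto simp: cut_def)
  then show ?thesis
    by (rule finite_subset) (intro finite_set_of_finite_funs, auto)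
qed

lemma measurable_cut [measurable]: "cut k \<in> measurable cantor cantor"
  by (rule measurable_cantorI) (simp add: cut_def)

lemma compact_space_bool_sequences: "compact_space (euclidean :: (nat \<Rightarrow> bool) topology)"
proof -
  have "compact_space (euclidean :: bool topology)"
    by (simp add: compact_space_def finite_imp_compact)
  then have "compact_space (product_topology (\<lambda>_::nat. euclidean :: bool topology) UNIV)"
    by (subst compact_space_product_topology) simp
  then show ?thesis by (simp add: euclidean_product_topology)
qed

text \<open>Only finitely many coordinates matter, so the set is a finite union of
  cylinders.\<close>

lemma closed_cut_vimage: "closed {y. P (cut k y)}"
proof -
  have "closed {y :: nat \<Rightarrow> bool. y i = b}" for i b
    using closed_vimage[of "{b}" "\<lambda>y :: nat \<Rightarrow> bool. y i"] by (simp add: vimage_def)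
  then have "closed (\<Union>s\<in>{s \<in> range (cut k). P s}. \<Inter>i\<in>{..<k}. {y :: nat \<Rightarrow> bool. y i = s i})"
    using finite_range_cut by (intro closed_UN closed_INT ballI) auto
  also have "(\<Union>s\<in>{s \<in> range (cut k). P s}. \<Inter>i\<in>{..<k}. {y :: nat \<Rightarrow> bool. y i = s i}) = {y. P (cut k y)}"
  proof (intro set_eqI iffI)
    fix y assume "y \<in> (\<Union>s\<in>{s \<in> range (cut k). P s}. \<Inter>i\<in>{..<k}. {y. y i = s i})"
    then obtain z where "P (cut k z)" "\<forall>i<k. y i = cut k z i" by auto
    then have "cut k y = cut k z" by (simp add: cut_eq_iff) (simp add: cut_def)
    with \<open>P (cut k z)\<close> show "y \<in> {y. P (cut k y)}" by simp
  next
    fix y assume "y \<in> {y. P (cut k y)}"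
    then show "y \<in> (\<Union>s\<in>{s \<in> range (cut k). P s}. \<Inter>i\<in>{..<k}. {y. y i = s i})"
      by (intro UN_I[of "cut k y"]) (auto simp: cut_def)
  qed
  finally show ?thesis .
qed

text \<open>\<open>D k y\<close> consists of the points having a witness that agrees with \<open>y\<close> up to \<open>k\<close>. Novikov
  separation applied to \<open>H\<close> makes it possible to replace these analytic sets by Borel sets \<open>R k y\<close>
  without changing the projection; compactness then turns the quantifier over witnesses into
  countable operations.\<close>

theorem projection_closed_sections:
  assumes B [measurable]: "B \<in> sets cantor"
    and cl: "\<And>u. closed {v. interleave u v \<in> B}"
  shows "{u. \<exists>v. interleave u v \<in> B} \<in> sets cantor"
proof -
  have an: "analytic_set {u. \<exists>v. P (interleave u v)}" if "Measurable.pred cantor P" for P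
    using analytic_set_projection[OF analytic_set_borel, of "{w. P w}"] that by (simp add: pred_def)
  \<comment> \<open>\<open>w\<close> codes a pair \<open>(u, y)\<close> outside \<open>B\<close>
    such that the section of \<open>B\<close> at \<open>u\<close> has a point agreeing with
    \<open>y\<close> up to \<open>k\<close>. For a pair in every \<open>H k\<close>,
    \<open>y\<close> would be a limit of that closed section.\<close>
  define H where "H k = {w. \<exists>v. w \<notin> B \<and> cut k v = cut k (odds w) \<and> interleave (evens w) v \<in> B}" for k
  have "analytic_set (H k)" for k
  proof -
    have "Measurable.pred cantor (\<lambda>t. evens t \<notin> B \<and> cut k (odds t) = cut k (odds (evens t))
        \<and> interleave (evens (evens t)) (odds t) \<in> B)"
      by measurable
    from an[OF this] show ?thesis by (simp add: H_def)
  qed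
  moreover have "(\<Inter>k. H k) = {}"
  proof (rule equals0I)
    fix w assume "w \<in> (\<Inter>k. H k)"
    then have w: "w \<notin> B" "\<And>k. \<exists>v\<in>{v. interleave (evens w) v \<in> B}. \<forall>i<k. v i = odds w i"
      unfolding H_def cut_eq_iff by auto
    have "odds w \<in> {v. interleave (evens w) v \<in> B}"
      using cl w(2) by (rule closed_prefix_limit)
    with w(1) show False by simp
  qed
  ultimately have "separable_family H" by (rule novikov_separation)
  then obtain Q where Q [measurable]: "\<And>k. Q k \<in> sets cantor"
    and HQ: "\<And>k. H k \<subseteq> Q k" and Q_empty: "(\<Inter>k. Q k) = {}"
    unfolding separable_family_def by blast
  define D where "D k y = {u. \<exists>v. cut k v = cut k y \<and> interleave u v \<in> B}" for k y
  define L where "L k y = {u. \<exists>v. cut k v = cut k y \<and> interleave u v \<notin> B \<and> interleave u v \<notin> Q k}" for k y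
  have "\<exists>R. R \<in> sets cantor \<and> D k y \<subseteq> R \<and> R \<inter> L k y = {}" for k y
  proof -
    have "Measurable.pred cantor (\<lambda>w. cut k (odds w) = cut k y \<and> w \<in> B)"
      by measurable
    from an[OF this] have "analytic_set (D k y)" by (simp add: D_def)
    moreover have "Measurable.pred cantor (\<lambda>w. cut k (odds w) = cut k y \<and> w \<notin> B \<and> w \<notin> Q k)"
      by measurable
    from an[OF this] have "analytic_set (L k y)" by (simp add: L_def)
    \<comment> \<open>If \<open>u\<close> has a witness in the cylinder of \<open>y\<close>, every
      pair outside \<open>B\<close> over \<open>u\<close> and that cylinder lies in
      \<open>H k\<close>, hence in \<open>Q k\<close>.\<close>
    moreover have "D k y \<inter> L k y = {}"
      using HQ[of k] by (force simp: D_def L_def H_def)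
    ultimately show ?thesis by (rule lusin_separation) blast
  qed
  then obtain R where R [measurable]: "\<And>k y. R k y \<in> sets cantor"
    and DR: "\<And>k y. D k y \<subseteq> R k y" and RL: "\<And>k y. R k y \<inter> L k y = {}"
    by metis
  have "{u. \<exists>v. interleave u v \<in> B} =
      {u. \<forall>m. \<exists>y\<in>range (cut m). \<forall>k\<in>{..m}. u \<in> R k (cut k y)}" (is "?P = ?R")
  proof (intro set_eqI iffI)
    fix u assume "u \<in> ?P"
    then obtain v where v: "interleave u v \<in> B" by blast
    have "u \<in> R k (cut k (cut m v))" if "k \<le> m" for k m
      using v DR[of k "cut k v"] that by (auto simp: D_def cut_cut)
    then show "u \<in> ?R" by blast
  next
    fix u assume u: "u \<in> ?R"
    define C where "C m = {y. \<forall>k\<in>{..m}. u \<in> R k (cut k y)}" for m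
    have "closed {y. u \<in> R k (cut k y)}" for k
      by (rule closed_cut_vimage[where P = "\<lambda>s. u \<in> R k s"])
    then have "closed (\<Inter>k\<in>{..m}. {y. u \<in> R k (cut k y)})" for m by blast
    moreover have "C m = (\<Inter>k\<in>{..m}. {y. u \<in> R k (cut k y)})" for m by (auto simp: C_def)
    ultimately have "closed (C m)" for m by simp
    moreover have "C m \<noteq> {}" for m using u by (auto simp: C_def)
    moreover have "decseq C" by (auto simp: decseq_def C_def)
    ultimately have "(\<Inter>m. C m) \<noteq> {}"
      using compact_space_imp_nest[OF compact_space_bool_sequences, of C] by simp
    then obtain y where y: "\<And>k. u \<in> R k (cut k y)" by (auto simp: C_def)
    \<comment> \<open>A pair outside \<open>B\<close> is missed by some \<open>Q k\<close>, which
      puts \<open>u\<close> into \<open>L k (cut k y)\<close>, a set disjoint from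
      \<open>R k (cut k y)\<close>.\<close>
    have "interleave u y \<in> B"
    proof (rule ccontr)
      assume nB: "interleave u y \<notin> B"
      obtain k where "interleave u y \<notin> Q k" using Q_empty by blast
      with nB have "u \<in> L k (cut k y)" by (auto simp: L_def cut_cut)
      with y[of k] RL[of k "cut k y"] show False by blast
    qed
    then show "u \<in> ?P" by blast
  qed
  also have "\<dots> \<in> sets cantor"
  proof -
    have "Measurable.pred cantor (\<lambda>u. \<forall>m. \<exists>y\<in>range (cut m). \<forall>k\<in>{..m}. u \<in> R k (cut k y))"
      using finite_range_cut by (intro pred_intros_countable pred_intros_finite) auto
    then show ?thesis by (simp add: pred_def)
  qed
  finally show ?thesis .
qed

subsection \<open>Standard Borel spaces as retracts of Cantor space\<close>

text \<open>A point \<open>x\<close> is coded by the relation \<open>d x (q n) < (1/2)^k\<close> for a dense sequence \<open>q\<close>, and it is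
  recovered as the limit over \<open>k\<close> of the first \<open>q n\<close> that the code declares \<open>(1/2)^k\<close>-close.\<close>

lemma standard_borel_retract_cantor:
  fixes M :: "'a measure"
  assumes sb: "standard_borel M" and ne: "space M \<noteq> {}"
  obtains f g where "f \<in> measurable M cantor" "g \<in> measurable cantor M"
    "\<And>x. x \<in> space M \<Longrightarrow> g (f x) = x"
proof -
  obtain T where T: "completely_metrizable_space T" "second_countable T" "topspace T = space M"
    and setsM: "sets M = sigma_sets (topspace T) {U. openin T U}"
    using sb unfolding standard_borel_def by blast
  obtain X d where "Metric_space X d" and complete: "Metric_space.mcomplete X d"
    and T_eq: "T = Metric_space.mtopology X d"
    using T(1) unfolding completely_metrizable_space_def by blast
  interpret Metric_space X d by fact
  have X: "X = space M" using T(3) T_eq by simp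
  obtain U where U: "countable U" "U \<subseteq> X" "T closure_of U = X"
    using second_countable_imp_separable_space[OF T(2)] T(3) X unfolding separable_space_def by auto
  have "U \<noteq> {}" using U(3) ne X by auto
  define q where "q = from_nat_into U"
  have range_q: "range q = U"
    unfolding q_def using \<open>U \<noteq> {}\<close> U(1) by (rule range_from_nat_into)
  have qX [simp]: "q n \<in> X" for n using range_q U(2) by blast
  define r :: "nat \<Rightarrow> real" where "r k = (1/2)^k" for k
  have r_pos [simp]: "r k > 0" for k by (simp add: r_def)
  have r_Suc: "r (Suc k) = r k / 2" for k by (simp add: r_def)
  have r_small: "\<exists>k. r k < e" if "e > 0" for e
    unfolding r_def using that by (intro real_arch_pow_inv) auto
  have dense: "\<exists>n. d x (q n) < r k" if "x \<in> X" for x k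
  proof -
    have "x \<in> T closure_of U" using that U(3) by simp
    then obtain y where "y \<in> U" "y \<in> mball x (r k)"
      unfolding T_eq metric_closure_of using r_pos by blast
    then show ?thesis using range_q by auto
  qed
  define f where "f x i = (case prod_decode i of (k, n) \<Rightarrow> d x (q n) < r k)" for x i
  have f: "f \<in> measurable M cantor"
  proof (rule measurable_cantorI)
    fix i
    obtain k n where kn: "prod_decode i = (k, n)" by fastforce
    have "mball (q n) (r k) \<in> sets M"
      unfolding setsM T_eq by (rule sigma_sets.Basic) simp
    also have "mball (q n) (r k) = {x \<in> space M. f x i}"
      by (auto simp: f_def kn X[symmetric] commute)
    finally show "Measurable.pred M (\<lambda>x. f x i)" by (simp add: pred_def)
  qed
  define idx where "idx c k = (LEAST n. c (prod_encode (k, n)))" for c :: "nat \<Rightarrow> bool" and k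
  have idx [measurable]: "(\<lambda>c. idx c k) \<in> measurable cantor (count_space UNIV)" for k
    unfolding idx_def by measurable
  \<comment> \<open>For the code of a point, consecutive approximations are less than
    \<open>r k + r (Suc k)\<close> apart, which is below \<open>2 * r k\<close>. Other codes are
    sent to the default \<open>x0\<close>.\<close>
  define good where "good c \<longleftrightarrow> (\<forall>k. d (q (idx c k)) (q (idx c (Suc k))) < 2 * r k)" for c
  have [measurable]: "Measurable.pred cantor good"
    unfolding good_def by measurable
  \<comment> \<open>\<open>4 * r k\<close> is the sum of the geometric tail of step bounds starting
    with \<open>2 * r k\<close>.\<close>
  define lim_at where "lim_at c l \<longleftrightarrow> l \<in> X \<and> (\<forall>k. d (q (idx c k)) l \<le> 4 * r k)" for c l
  have lim_ex: "\<exists>l. lim_at c l" if "good c" for c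
  proof -
    define s where "s k = q (idx c k)" for k
    have s: "d (s k) (s (k + j)) \<le> 4 * r k - 4 * r (k + j)" for k j
    proof (induction j)
      case (Suc j)
      have "d (s k) (s (k + Suc j)) \<le> d (s k) (s (k + j)) + d (s (k + j)) (s (Suc (k + j)))"
        using triangle[of "s k" "s (k + j)" "s (Suc (k + j))"] by (simp add: s_def)
      also have "d (s (k + j)) (s (Suc (k + j))) < 2 * r (k + j)"
        using that unfolding good_def s_def by blast
      finally show ?case using Suc by (simp add: r_Suc)
    qed (simp add: s_def)
    have s': "d (s k) (s n) < 4 * r k" if "k \<le> n" for k n
    proof -
      have "d (s k) (s n) \<le> 4 * r k - 4 * r n" using s[of k "n - k"] that by simp
      then show ?thesis using r_pos[of n] by linarith
    qed
    have "MCauchy s"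
      unfolding MCauchy_def
    proof (intro conjI allI impI)
      show "range s \<subseteq> X" by (auto simp: s_def)
      fix e :: real assume "e > 0"
      then obtain k where k: "r k < e / 8" using r_small[of "e / 8"] by auto
      have "d (s n) (s m) < e" if "k \<le> n" "k \<le> m" for n m
        using triangle''[of "s n" "s k" "s m"] s'[OF that(1)] s'[OF that(2)] k commute[of "s n" "s k"]
          triangle[of "s n" "s k" "s m"]
        by (simp add: s_def)
      then show "\<exists>N. \<forall>n n'. N \<le> n \<longrightarrow> N \<le> n' \<longrightarrow> d (s n) (s n') < e" by blast
    qed
    then obtain l where l: "limitin mtopology s l sequentially"
      using complete unfolding mcomplete_def by blast
    then have lX: "l \<in> X" using limitin_mspace by blast
    have "d (s k) l \<le> 4 * r k" for k
    proof (rule field_le_epsilon)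
      fix e :: real assume "e > 0"
      then obtain N where N: "\<And>n. n \<ge> N \<Longrightarrow> d (s n) l < e"
        using l unfolding limit_metric_sequentially by blast
      show "d (s k) l \<le> 4 * r k + e"
        using triangle[of "s k" "s (max k N)" l] s'[of k "max k N"] N[of "max k N"] lX
        by (simp add: s_def)
    qed
    then show ?thesis using lX by (auto simp: lim_at_def s_def)
  qed
  obtain x0 where x0: "x0 \<in> X" using ne X by blast
  define g where "g c = (if good c then SOME l. lim_at c l else x0)" for c
  have g_lim: "lim_at c (g c)" if "good c" for c
    using someI_ex[OF lim_ex[OF that]] that by (simp add: g_def)
  have gX: "g c \<in> X" for c
    using g_lim[of c] x0 by (cases "good c") (auto simp: lim_at_def g_def)
  have g: "g \<in> measurable cantor M"
  proof (rule measurable_sigma_sets[OF setsM])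
    show "{U. openin T U} \<subseteq> Pow (topspace T)" using openin_subset by blast
    show "g \<in> space cantor \<rightarrow> topspace T" using gX T(3) X by simp
    fix V assume "V \<in> {U. openin T U}"
    then have V: "V \<subseteq> X" "\<And>x. x \<in> V \<Longrightarrow> \<exists>e>0. mball x e \<subseteq> V"
      by (auto simp: T_eq openin_mtopology)
    \<comment> \<open>For good codes, membership in an open set is tested by closed balls around
      approximations. Each test sees the code only through the number \<open>idx c k\<close>, which
      gives measurability.\<close>
    have "g c \<in> V \<longleftrightarrow> (if good c then \<exists>k. \<forall>y\<in>X. d (q (idx c k)) y \<le> 4 * r k \<longrightarrow> y \<in> V else x0 \<in> V)" for c
    proof (cases "good c")
      case True
      have lim: "g c \<in> X" "\<And>k. d (q (idx c k)) (g c) \<le> 4 * r k"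
        using g_lim[OF True] by (auto simp: lim_at_def)
      have "\<exists>k. \<forall>y\<in>X. d (q (idx c k)) y \<le> 4 * r k \<longrightarrow> y \<in> V" if gV: "g c \<in> V"
      proof -
        obtain e where e: "e > 0" "mball (g c) e \<subseteq> V" using V(2)[OF gV] by blast
        obtain k where k: "r k < e / 8" using r_small[of "e / 8"] e(1) by auto
        have "y \<in> V" if "y \<in> X" "d (q (idx c k)) y \<le> 4 * r k" for y
        proof -
          have "d (g c) y < e"
            using triangle[OF lim(1) qX[of "idx c k"] that(1)] lim(2)[of k] that(2) k commute[of "g c" "q (idx c k)"]
            by linarith
          with that(1) lim(1) e(2) show ?thesis by auto
        qed
        then show ?thesis by blast
      qed
      then show ?thesis using lim True by auto
    qed (simp add: g_def)
    then have "g -` V \<inter> space cantor =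
      {c \<in> space cantor. if good c then \<exists>k. \<forall>y\<in>X. d (q (idx c k)) y \<le> 4 * r k \<longrightarrow> y \<in> V else x0 \<in> V}"
      by (simp add: vimage_def)
    also have "\<dots> \<in> sets cantor"
    proof -
      have [measurable]: "Measurable.pred cantor (\<lambda>c. \<forall>y\<in>X. d (q (idx c k)) y \<le> 4 * r k \<longrightarrow> y \<in> V)" for k
        by (rule measurable_compose[OF idx, where g = "\<lambda>n. \<forall>y\<in>X. d (q n) y \<le> 4 * r k \<longrightarrow> y \<in> V"]) simp
      show ?thesis by measurable
    qed
    finally show "g -` V \<inter> space cantor \<in> sets cantor" .
  qed
  have "g (f x) = x" if "x \<in> space M" for x
  proof -
    have x: "x \<in> X" using that X by simp
    have close: "d x (q (idx (f x) k)) < r k" for k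
      using LeastI_ex[OF dense[OF x, of k]] by (simp add: idx_def f_def)
    have "good (f x)"
      unfolding good_def
    proof
      fix k
      show "d (q (idx (f x) k)) (q (idx (f x) (Suc k))) < 2 * r k"
        using triangle[OF qX[of "idx (f x) k"] x qX[of "idx (f x) (Suc k)"]] close[of k] close[of "Suc k"]
          commute[of x "q (idx (f x) k)"] r_Suc[of k] r_pos[of k] by linarith
    qed
    then have lim: "lim_at (f x) (g (f x))" by (rule g_lim)
    have "d x (g (f x)) < 5 * r k" for k
    proof -
      have "d x (g (f x)) \<le> d x (q (idx (f x) k)) + d (q (idx (f x) k)) (g (f x))"
        by (intro triangle x qX gX)
      moreover have "d (q (idx (f x) k)) (g (f x)) \<le> 4 * r k" using lim by (simp add: lim_at_def)
      ultimately show ?thesis using close[of k] by linarith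
    qed
    then have "\<not> r k < d x (g (f x)) / 5" for k by (simp add: not_less less_imp_le mult.commute)
    then have "\<not> 0 < d x (g (f x)) / 5" using r_small by blast
    then show ?thesis using x gX[of "f x"] mdist_pos_less[of x "g (f x)"] by fastforce
  qed
  with f g show ?thesis by (rule that)
qed

subsection \<open>Borel sets with finite sections and coded finite sets\<close>

lemma closed_finite_cantor:
  fixes F :: "(nat \<Rightarrow> bool) set"
  assumes "finite F"
  shows "closed F"
proof -
  have "closed {v}" for v :: "nat \<Rightarrow> bool"
  proof -
    have "closed (\<Inter>i. (\<lambda>y :: nat \<Rightarrow> bool. y i) -` {v i})"
      by (intro closed_INT ballI closed_vimage continuous_on_product_coordinates) simp
    also have "(\<Inter>i. (\<lambda>y :: nat \<Rightarrow> bool. y i) -` {v i}) = {v}" by auto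
    finally show ?thesis .
  qed
  with closed_UN[OF assms, of "\<lambda>v. {v}"] show ?thesis by simp
qed

text \<open>Replacing \<open>x\<close> by \<open>g u\<close> moves the set to Cantor space, where
  finite sections are closed; pulling the projection back along \<open>f\<close> recovers the
  original one since \<open>g (f x) = x\<close>.\<close>

lemma projection_finite_sections:
  assumes f [measurable]: "f \<in> measurable M cantor" and g [measurable]: "g \<in> measurable cantor M"
    and gf: "\<And>x. x \<in> space M \<Longrightarrow> g (f x) = x"
    and B [measurable]: "B \<in> sets (M \<Otimes>\<^sub>M cantor)"
    and fin: "\<And>x. x \<in> space M \<Longrightarrow> finite {v. (x, v) \<in> B}"
  shows "{x \<in> space M. \<exists>v. (x, v) \<in> B} \<in> sets M"
proof -
  define B' where "B' = {w \<in> space cantor. (g (evens w), odds w) \<in> B}"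
  have "B' \<in> sets cantor" unfolding B'_def by measurable
  moreover have B': "interleave u v \<in> B' \<longleftrightarrow> (g u, v) \<in> B" for u v by (simp add: B'_def)
  moreover have "closed {v. (g u, v) \<in> B}" for u
    using measurable_space[OF g, of u] by (intro closed_finite_cantor fin) simp
  ultimately have "{u. \<exists>v. (g u, v) \<in> B} \<in> sets cantor"
    using projection_closed_sections[of B'] by simp
  from measurable_sets[OF f this] show ?thesis
    by (rule back_subst[where P = "\<lambda>A. A \<in> sets M"]) (auto simp: gf)
qed

text \<open>When \<open>g\<close> undoes \<open>f\<close>, these maps make the square of
  \<open>M\<close> a retract of Cantor space too.\<close>

lemma measurable_pair_code:
  assumes [measurable]: "f \<in> measurable M cantor" "g \<in> measurable cantor M"
  shows "(\<lambda>p. interleave (f (fst p)) (f (snd p))) \<in> measurable (M \<Otimes>\<^sub>M M) cantor"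
    and "(\<lambda>w. (g (evens w), g (odds w))) \<in> measurable cantor (M \<Otimes>\<^sub>M M)"
  by measurable

section \<open>Coding finite sets by points of Cantor space\<close>

definition row :: "(nat \<Rightarrow> bool) \<Rightarrow> nat \<Rightarrow> nat \<Rightarrow> bool" where
  "row v i n = v (prod_encode (i, n))"

lemma measurable_row [measurable (raw)]:
  assumes [measurable]: "h \<in> measurable M cantor"
  shows "(\<lambda>x. row (h x) i) \<in> measurable M cantor"
  by (rule measurable_cantorI) (simp add: row_def)

context
  fixes M :: "'a measure" and f :: "'a \<Rightarrow> nat \<Rightarrow> bool" and g :: "(nat \<Rightarrow> bool) \<Rightarrow> 'a"
  assumes f [measurable]: "f \<in> measurable M cantor" and g [measurable]: "g \<in> measurable cantor M"
    and gf: "\<And>x. x \<in> space M \<Longrightarrow> g (f x) = x"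
begin

text \<open>A \<open>k\<close>-element subset of \<open>space M\<close> is coded by the \<open>f\<close>-codes of its elements in the
  rows \<open>i < k\<close>. The conditions in \<open>set_code\<close> leave each set only finitely many codes.\<close>

definition decoded_set :: "nat \<Rightarrow> (nat \<Rightarrow> bool) \<Rightarrow> 'a set" where
  "decoded_set k v = (\<lambda>i. g (row v i)) ` {..<k}"

definition set_code :: "nat \<Rightarrow> (nat \<Rightarrow> bool) \<Rightarrow> bool" where
  "set_code k v \<longleftrightarrow> (\<forall>i\<in>{..<k}. f (g (row v i)) = row v i) \<and> (\<forall>i. \<forall>n. k \<le> i \<longrightarrow> \<not> row v i n) \<and>
     (\<forall>i\<in>{..<k}. \<forall>j\<in>{..<i}. row v i \<noteq> row v j)"

lemma g_space: "g c \<in> space M"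
  using measurable_space[OF g] by simp

text \<open>On generators: the decoded set meets \<open>A\<close> exactly when one of finitely many
  measurable maps lands in \<open>A\<close>.\<close>

lemma measurable_decoded_set [measurable]:
  "decoded_set k \<in> measurable cantor (finite_subsets_space M)"
  unfolding finite_subsets_space_def
proof (rule measurable_measure_of)
  show "{{F. finite F \<and> F \<subseteq> space M \<and> F \<inter> A \<noteq> {}} | A. A \<in> sets M} \<subseteq> Pow {F. finite F \<and> F \<subseteq> space M}"
    by auto
  show "decoded_set k \<in> space cantor \<rightarrow> {F. finite F \<and> F \<subseteq> space M}"
    using g_space by (auto simp: decoded_set_def)
  fix Y assume "Y \<in> {{F. finite F \<and> F \<subseteq> space M \<and> F \<inter> A \<noteq> {}} | A. A \<in> sets M}"
  then obtain A where A [measurable]: "A \<in> sets M"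
    and Y: "Y = {F. finite F \<and> F \<subseteq> space M \<and> F \<inter> A \<noteq> {}}" by blast
  have "decoded_set k -` Y \<inter> space cantor = {v \<in> space cantor. \<exists>i\<in>{..<k}. g (row v i) \<in> A}"
    using g_space by (auto simp: Y decoded_set_def)
  also have "\<dots> \<in> sets cantor" by measurable
  finally show "decoded_set k -` Y \<inter> space cantor \<in> sets cantor" .
qed

lemma measurable_set_code [measurable]: "Measurable.pred cantor (set_code k)"
  unfolding set_code_def by measurable

text \<open>Membership becomes equality in Cantor space, a Borel condition on point and code
  jointly.\<close>

lemma mem_decoded_set_iff:
  assumes "set_code k v" "x \<in> space M"
  shows "x \<in> decoded_set k v \<longleftrightarrow> (\<exists>i\<in>{..<k}. f x = row v i)"
proof
  assume "x \<in> decoded_set k v"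
  then obtain i where "i < k" "x = g (row v i)" by (auto simp: decoded_set_def)
  with assms(1) show "\<exists>i\<in>{..<k}. f x = row v i"
    unfolding set_code_def by (metis lessThan_iff)
next
  assume "\<exists>i\<in>{..<k}. f x = row v i"
  then obtain i where "i < k" "f x = row v i" by auto
  then have "x = g (row v i)" using gf[OF assms(2)] by simp
  with \<open>i < k\<close> show "x \<in> decoded_set k v" by (auto simp: decoded_set_def)
qed

lemma card_decoded_set:
  assumes "set_code k v"
  shows "card (decoded_set k v) = k"
proof -
  have "inj_on (\<lambda>i. g (row v i)) {..<k}"
  proof (rule linorder_inj_onI')
    fix i j assume ij: "i \<in> {..<k}" "j \<in> {..<k}" "i < j"
    show "g (row v i) \<noteq> g (row v j)"
    proof
      assume "g (row v i) = g (row v j)"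
      then have "f (g (row v i)) = f (g (row v j))" by simp
      then have "row v i = row v j" using assms ij(1,2) by (simp add: set_code_def)
      moreover have "\<forall>i\<in>{..<k}. \<forall>j\<in>{..<i}. row v i \<noteq> row v j" using assms by (simp add: set_code_def)
      then have "row v j \<noteq> row v i" using ij by blast
      ultimately show False by simp
    qed
  qed
  then show ?thesis by (simp add: decoded_set_def card_image)
qed

lemma ex_set_code:
  assumes "finite J" "J \<subseteq> space M"
  shows "\<exists>v. set_code (card J) v \<and> decoded_set (card J) v = J"
proof -
  obtain z where z: "bij_betw z {..<card J} J"
    using ex_bij_betw_nat_finite[OF assms(1)] by (auto simp: atLeast0LessThan)
  define v where "v m = (case prod_decode m of (i, n) \<Rightarrow> i < card J \<and> f (z i) n)" for m
  have row: "row v i = (if i < card J then f (z i) else (\<lambda>_. False))" for i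
    by (auto simp: row_def v_def fun_eq_iff)
  have gz: "g (f (z i)) = z i" if "i < card J" for i
    using z that assms(2) by (intro gf) (auto simp: bij_betw_def)
  have "f (z i) \<noteq> f (z j)" if "i < card J" "j < i" for i j
    using z gz[of i] gz[of j] that unfolding bij_betw_def inj_on_def by (metis lessThan_iff less_trans less_irrefl)
  then have "set_code (card J) v"
    by (auto simp: set_code_def row gz)
  moreover have "decoded_set (card J) v = z ` {..<card J}"
    unfolding decoded_set_def by (intro image_cong refl) (simp add: row gz)
  ultimately show ?thesis using z by (auto simp: bij_betw_def)
qed

text \<open>A code is determined by the tuple of its decoded points, because each row below
  \<open>k\<close> is the \<open>f\<close>-code of its point and later rows are empty.\<close>

lemma finite_set_codes:
  assumes "finite \<J>"
  shows "finite {v. set_code k v \<and> decoded_set k v \<in> \<J>}"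
proof -
  \<comment> \<open>Decoded sets are finite; keeping only the finite members makes the union
    finite.\<close>
  define \<J>' where "\<J>' = {J \<in> \<J>. finite J}"
  define enc where "enc z m = (case prod_decode m of (i, n) \<Rightarrow> i < k \<and> f (z i) n)" for z m
  have enc: "v \<in> enc ` (\<Pi>\<^sub>E i\<in>{..<k}. \<Union>\<J>')" if v: "set_code k v" "decoded_set k v \<in> \<J>" for v
  proof (rule image_eqI)
    show "v = enc (\<lambda>i\<in>{..<k}. g (row v i))"
    proof
      fix m
      obtain i n where m: "m = prod_encode (i, n)" by (metis prod_decode_inverse surj_pair)
      have "row v i n \<longleftrightarrow> i < k \<and> f (g (row v i)) n"
        using v(1) by (cases "i < k") (auto simp: set_code_def)
      then show "v m = enc (\<lambda>i\<in>{..<k}. g (row v i)) m"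
        by (auto simp: enc_def m row_def)
    qed
    have "decoded_set k v \<in> \<J>'" using v by (simp add: \<J>'_def decoded_set_def)
    then show "(\<lambda>i\<in>{..<k}. g (row v i)) \<in> (\<Pi>\<^sub>E i\<in>{..<k}. \<Union>\<J>')"
      by (auto simp: decoded_set_def)
  qed
  have "finite (\<Pi>\<^sub>E i\<in>{..<k}. \<Union>\<J>')"
    using assms by (intro finite_PiE) (auto simp: \<J>'_def)
  then have "finite (enc ` (\<Pi>\<^sub>E i\<in>{..<k}. \<Union>\<J>'))"
    by (rule finite_imageI)
  then show ?thesis
    by (rule finite_subset[rotated], intro subsetI, elim CollectE conjE) (rule enc)
qed

text \<open>A projection along codes: each separating member of size \<open>k\<close> has at least
  one code and only finitely many, so the sections are finite.\<close>

lemma sets_separated_pairs: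
  assumes E [measurable]: "E \<in> sets (M \<Otimes>\<^sub>M M)" and W [measurable]: "W \<in> sets (finite_subsets_space M)"
    and fin: "\<And>x y. (x, y) \<in> E \<Longrightarrow> finite {J \<in> W. (x \<in> J) \<noteq> (y \<in> J)}"
  shows "{(x, y) \<in> E. \<exists>J\<in>W. card J = k \<and> (x \<in> J) \<noteq> (y \<in> J)} \<in> sets (M \<Otimes>\<^sub>M M)"
proof -
  define S where "S p v \<longleftrightarrow> p \<in> E \<and> set_code k v \<and> decoded_set k v \<in> W \<and>
      ((\<exists>i\<in>{..<k}. f (fst p) = row v i) \<noteq> (\<exists>i\<in>{..<k}. f (snd p) = row v i))" for p v
  define B where "B = {q \<in> space ((M \<Otimes>\<^sub>M M) \<Otimes>\<^sub>M cantor). S (fst q) (snd q)}"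
  have W_sub: "finite J \<and> J \<subseteq> space M" if "J \<in> W" for J
    using sets.sets_into_space[OF W] that
    unfolding finite_subsets_space_def by (subst (asm) space_measure_of) auto
  have E_sub: "x \<in> space M" "y \<in> space M" if "(x, y) \<in> E" for x y
    using sets.sets_into_space[OF E] that by (auto simp: space_pair_measure)
  have S_iff: "S (x, y) v \<longleftrightarrow> (x, y) \<in> E \<and> set_code k v \<and> decoded_set k v \<in> W \<and>
      (x \<in> decoded_set k v) \<noteq> (y \<in> decoded_set k v)" for x y v
    unfolding S_def using mem_decoded_set_iff E_sub by (metis fst_conv snd_conv)
  have B_iff: "((x, y), v) \<in> B \<longleftrightarrow> S (x, y) v" for x y v
    using E_sub by (auto simp: B_def space_pair_measure S_def)
  have B: "B \<in> sets ((M \<Otimes>\<^sub>M M) \<Otimes>\<^sub>M cantor)"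
    unfolding B_def S_def by measurable
  have B_fin: "finite {v. (p, v) \<in> B}" for p
  proof (cases "p \<in> E")
    case True
    obtain x y where p: "p = (x, y)" by fastforce
    have "finite {v. set_code k v \<and> decoded_set k v \<in> {J \<in> W. (x \<in> J) \<noteq> (y \<in> J)}}"
      using fin True unfolding p by (intro finite_set_codes) blast
    then show ?thesis
      by (rule finite_subset[rotated]) (auto simp: p B_iff S_iff)
  next
    case False
    then show ?thesis by (auto simp: B_def S_def)
  qed
  have "{p \<in> space (M \<Otimes>\<^sub>M M). \<exists>v. (p, v) \<in> B} \<in> sets (M \<Otimes>\<^sub>M M)"
  proof (rule projection_finite_sections[OF _ _ _ B B_fin])
    show "(\<lambda>p. interleave (f (fst p)) (f (snd p))) \<in> measurable (M \<Otimes>\<^sub>M M) cantor"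
      using f g by (rule measurable_pair_code)
    show "(\<lambda>w. (g (evens w), g (odds w))) \<in> measurable cantor (M \<Otimes>\<^sub>M M)"
      using f g by (rule measurable_pair_code)
  qed (use gf in \<open>auto simp: space_pair_measure\<close>)
  also have "{p \<in> space (M \<Otimes>\<^sub>M M). \<exists>v. (p, v) \<in> B} =
      {(x, y) \<in> E. \<exists>J\<in>W. card J = k \<and> (x \<in> J) \<noteq> (y \<in> J)}"
  proof -
    have S: "(\<exists>v. S (x, y) v) \<longleftrightarrow> (x, y) \<in> E \<and> (\<exists>J\<in>W. card J = k \<and> (x \<in> J) \<noteq> (y \<in> J))" for x y
      using W_sub ex_set_code card_decoded_set unfolding S_iff by metis
    show ?thesis
    proof (rule set_eqI)
      fix p :: "'a \<times> 'a"
      obtain x y where p: "p = (x, y)" by fastforce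
      show "p \<in> {p \<in> space (M \<Otimes>\<^sub>M M). \<exists>v. (p, v) \<in> B} \<longleftrightarrow>
          p \<in> {(x, y) \<in> E. \<exists>J\<in>W. card J = k \<and> (x \<in> J) \<noteq> (y \<in> J)}"
        using E_sub[of x y] by (auto simp: p B_iff S space_pair_measure)
    qed
  qed
  finally show ?thesis .
qed

end

subsection \<open>Hyperfiniteness\<close>

theorem corollary6p9:
  fixes M :: "'a measure" and E :: "('a \<times> 'a) set"
  assumes "standard_borel M"
    and "countable_borel_equiv M E"
    and "\<exists>W. one_ended_proper_walling M E W"
  shows "hyperfinite M E"
proof -
  obtain W where W: "one_ended_proper_walling M E W" using assms(3) by blast
  have equiv: "equiv (space M) E" and E: "E \<in> sets (M \<Otimes>\<^sub>M M)"
    using assms(2) by (auto simp: countable_borel_equiv_def borel_equiv_def)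
  have W_sets: "W \<in> sets (finite_subsets_space M)"
    and W_class: "\<And>I. I \<in> W \<Longrightarrow> finite I \<and> I \<noteq> {} \<and> (\<exists>C\<in>space M // E. I \<subseteq> C)"
    and wall: "\<And>C. C \<in> space M // E \<Longrightarrow> one_ended_proper_wallspace C {I \<in> W. I \<subseteq> C}"
    using W by (auto simp: one_ended_proper_walling_def)
  have E_sub: "x \<in> space M" "y \<in> space M" if "(x, y) \<in> E" for x y
    using sets.sets_into_space[OF E] that by (auto simp: space_pair_measure)
  \<comment> \<open>Members containing \<open>x\<close> all belong to the wallspace of its class,
    which transfers finiteness from that wallspace to \<open>W\<close>.\<close>
  have W_sub: "J \<subseteq> E `` {x}" if J: "J \<in> W" "x \<in> J" for J x
  proof -
    obtain C where C: "C \<in> space M // E" "J \<subseteq> C" using W_class[OF J(1)] by blast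
    moreover have "C = E `` {x}"
      using C J(2) equiv by (metis Image_singleton_iff equiv_class_eq quotientE subsetD)
    ultimately show ?thesis by simp
  qed
  have one_sided: "finite {J \<in> W. x \<in> J \<and> y \<notin> J}" if "(x, y) \<in> E" for x y
  proof -
    have x: "x \<in> space M" using E_sub that by blast
    have "finite {J \<in> {I \<in> W. I \<subseteq> E `` {x}}. x \<in> J \<and> y \<notin> J}"
      using wall[OF quotientI[OF x]] that equiv_class_self[OF equiv x]
      unfolding one_ended_proper_wallspace_def by blast
    then show ?thesis by (rule finite_subset[rotated]) (use W_sub in blast)
  qed
  have sep_fin: "finite {J \<in> W. (x \<in> J) \<noteq> (y \<in> J)}" if "(x, y) \<in> E" for x y
  proof -
    have "(y, x) \<in> E" using equiv that by (meson equivE symD)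
    then have "finite ({J \<in> W. x \<in> J \<and> y \<notin> J} \<union> {J \<in> W. y \<in> J \<and> x \<notin> J})"
      using one_sided that by blast
    then show ?thesis by (rule finite_subset[rotated]) blast
  qed
  define sep where "sep k = {(x, y) \<in> E. \<exists>J\<in>W. card J = k \<and> (x \<in> J) \<noteq> (y \<in> J)}" for k
  have sep: "sep k \<in> sets (M \<Otimes>\<^sub>M M)" for k
  \<comment> \<open>The total function \<open>g\<close> needs a point of \<open>space M\<close> as
    value, so the empty space is treated apart.\<close>
  proof (cases "space M = {}")
    case True
    then have "sep k = {}" using E_sub by (auto simp: sep_def)
    then show ?thesis by simp
  next
    case False
    obtain f g where "f \<in> measurable M cantor" "g \<in> measurable cantor M"
      "\<And>x. x \<in> space M \<Longrightarrow> g (f x) = x"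
      using standard_borel_retract_cantor[OF assms(1) False] by metis
    then show ?thesis
      unfolding sep_def using E W_sets sep_fin by (rule sets_separated_pairs)
  qed
  define F where "F n = {(x, y) \<in> E. \<forall>J\<in>W. n \<le> card J \<longrightarrow> (x \<in> J \<longleftrightarrow> y \<in> J)}" for n
  have "F n \<in> sets (M \<Otimes>\<^sub>M M)" for n
  proof -
    have "F n = E - (\<Union>k\<in>{n..}. sep k)" by (auto simp: F_def sep_def)
    then show ?thesis using E sep by auto
  qed
  moreover have "equiv (space M) (F n)" for n
  proof (rule equivI)
    show "F n \<subseteq> space M \<times> space M" using E_sub by (auto simp: F_def)
    show "refl_on (space M) (F n)" using equiv by (auto simp: F_def equiv_def refl_on_def)
    show "sym (F n)" using equiv by (auto simp: F_def equiv_def intro!: symI dest: symD)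
    show "trans (F n)" using equiv by (auto simp: F_def equiv_def intro!: transI dest: transD)
  qed
  moreover have "finite C" if C: "C \<in> space M // F n" for C n
  proof -
    obtain x where x: "x \<in> space M" "C = F n `` {x}" using C by (auto elim: quotientE)
    have "one_ended_proper_wallspace (E `` {x}) {I \<in> W. I \<subseteq> E `` {x}}"
      using x(1) by (intro wall quotientI)
    note wallspace = this[unfolded one_ended_proper_wallspace_def]
    note inf = wallspace[THEN conjunct1]
      and cover = wallspace[THEN conjunct2, THEN conjunct2, THEN conjunct1]
    \<comment> \<open>These \<open>n\<close> points force a covering member to have at least
      \<open>n\<close> elements; \<open>x\<close> is added so that its \<open>F n\<close>-class is
      trapped inside.\<close>
    obtain A where A: "finite A" "card A = n" "A \<subseteq> E `` {x}"
      using infinite_arbitrarily_large[OF inf] by blast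
    have "finite (insert x A)" "insert x A \<subseteq> E `` {x}"
      using A equiv_class_self[OF equiv x(1)] by auto
    then have "\<exists>J\<in>{I \<in> W. I \<subseteq> E `` {x}}. insert x A \<subseteq> J"
      using cover[rule_format, of "insert x A"] by simp
    then obtain J where J: "J \<in> W" "insert x A \<subseteq> J" by blast
    then have "n \<le> card J" using W_class A by (metis card_mono insert_subset)
    with J have "C \<subseteq> J" by (auto simp: x(2) F_def)
    then show ?thesis using W_class[OF J(1)] finite_subset by blast
  qed
  moreover have "F n \<subseteq> F (Suc n)" for n by (auto simp: F_def)
  moreover have "E = (\<Union>n. F n)"
  proof (intro equalityI subsetI)
    fix p assume p: "p \<in> E"
    obtain x y where xy: "p = (x, y)" by fastforce
    \<comment> \<open>Exceeds the size of every separating member; if there is none, the value of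
      \<open>Max\<close> is irrelevant.\<close>
    define n where "n = Suc (Max (card ` {J \<in> W. (x \<in> J) \<noteq> (y \<in> J)}))"
    have "card J < n" if "J \<in> W" "(x \<in> J) \<noteq> (y \<in> J)" for J
      using sep_fin[of x y] p xy that unfolding n_def less_Suc_eq_le by (intro Max_ge) auto
    then have "p \<in> F n" using p unfolding xy F_def by fastforce
    then show "p \<in> (\<Union>n. F n)" by blast
  qed (auto simp: F_def)
  ultimately show ?thesis
    unfolding hyperfinite_def finite_borel_equiv_def borel_equiv_def by blast
qed

end
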